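(* Let $\kappa$ be a weakly compact cardinal, $n$ a positive integer, and $A$ an abelian group with $|A|<\kappa$. Then every $n$-coherent family of $A$-valued functions indexed by $\kappa$ is $n$-trivial. In other words, $\check{\mathrm{H}}^n(\kappa,\mathcal{A}_d)=0$.
   Context: $f=^*g$ means the functions $f,g$ differ at only finitely many points (sums of functions with different domains are taken after restricting to the least domain). An $A$-valued family indexed by $\kappa$ is $\Phi=\{\varphi_{\vec\alpha}:\alpha_0\to A\mid\vec\alpha\in[\kappa]^n\}$, tuples $\vec\alpha=(\alpha_0<\dots<\alpha_{n-1})$; $\vec\alpha^i$ denotes $\vec\alpha$ with coordinate $i$ deleted. $\Phi$ is $n$-coherent if $\sum_{i=0}^n(-1)^i\varphi_{\vec\alpha^i}\restriction\alpha_0=^*0$ for all $\vec\alpha\in[\kappa]^{n+1}$. $\Phi$ is $n$-trivial if ($n=1$) there is $\varphi:\kappa\to A$ with $\varphi\restriction\beta=^*\varphi_\beta$ for all $\beta<\kappa$, or ($n>1$) there is $\{\psi_{\vec\beta}:\beta_0\to A\mid\vec\beta\in[\kappa]^{n-1}\}$ with $\sum_{i=0}^{n-1}(-1)^i\psi_{\vec\alpha^i}\restriction\alpha_0=^*\varphi_{\vec\alpha}$ for all $\vec\alpha\in[\kappa]^n$. $\mathcal{A}_d$ is the sheaf of locally constant $A$-valued functions, and $\check{\mathrm{H}}^n(\kappa,\mathcal{A}_d)$ is Čech cohomology of $\kappa$ with the order topology; for $n>0$ it is isomorphic to the group of $n$-coherent families indexed by $\kappa$ modulo the $n$-trivial ones.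 *)

theory Defs
  imports
    Complex_Main
    "HOL-Library.Countable_Set"
    "HOL-Library.Equipollence"
    "HOL-Library.Ramsey"
    "HOL-Algebra.Elementary_Groups"
begin

text \<open>A cardinal \<open>\<kappa>\<close> is represented by a well-ordered type whose order is a cardinal order, i.e.
  has minimal order type among the well-orders of its universe. Weak compactness is the
  partition relation \<open>\<kappa> \<longrightarrow> (\<kappa>)\<^sup>2\<^sub>2\<close> for uncountable \<open>\<kappa>\<close>.\<close>

definition weakly_compact :: "'k::wellorder itself \<Rightarrow> bool" where
  "weakly_compact _ \<longleftrightarrow>
     card_order {(x::'k, y). x \<le> y} \<and>
     uncountable (UNIV :: 'k set) \<and>
     (\<forall>f :: 'k set \<Rightarrow> bool. \<exists>H i. H \<approx> (UNIV :: 'k set) \<and> f ` nsets H 2 \<subseteq> {i})"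


text \<open>Signed summand \<open>(-1)\<^sup>i a\<close>, available in every abelian group.\<close>

definition alt :: "nat \<Rightarrow> 'a::ab_group_add \<Rightarrow> 'a" where
  "alt i a = (if even i then a else - a)"

definition del :: "nat \<Rightarrow> 'b list \<Rightarrow> 'b list" where
  "del i s = take i s @ drop (Suc i) s"


subsection \<open>Coherent and trivial families\<close>

definition incr_tuples :: "nat \<Rightarrow> 'k::linorder list set" where
  "incr_tuples n = {\<alpha>. length \<alpha> = n \<and> sorted_wrt (<) \<alpha>}"

definition eq_fin :: "'k set \<Rightarrow> ('k \<Rightarrow> 'a) \<Rightarrow> ('k \<Rightarrow> 'a) \<Rightarrow> bool" where
  "eq_fin D f g \<longleftrightarrow> finite {x \<in> D. f x \<noteq> g x}"

text \<open>A family \<open>\<phi>\<close> assigns a function to each tuple; only the restriction of \<open>\<phi> \<alpha>\<close> to the initial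
  segment \<open>{..<hd \<alpha>}\<close> (the ordinal \<open>\<alpha>\<^sub>0\<close>) and only increasing tuples of the right
  length are ever inspected.\<close>

definition n_coherent :: "nat \<Rightarrow> ('k::linorder list \<Rightarrow> 'k \<Rightarrow> 'a::ab_group_add) \<Rightarrow> bool" where
  "n_coherent n \<phi> \<longleftrightarrow>
     (\<forall>\<alpha> \<in> incr_tuples (Suc n).
        eq_fin {..<hd \<alpha>} (\<lambda>x. \<Sum>i\<le>n. alt i (\<phi> (del i \<alpha>) x)) (\<lambda>x. 0))"

definition n_trivial :: "nat \<Rightarrow> ('k::linorder list \<Rightarrow> 'k \<Rightarrow> 'a::ab_group_add) \<Rightarrow> bool" where
  "n_trivial n \<phi> \<longleftrightarrow>
     (if n = 1 then \<exists>\<psi> :: 'k \<Rightarrow> 'a. \<forall>\<beta>. eq_fin {..<\<beta>} \<psi> (\<phi> [\<beta>])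
      else \<exists>\<psi> :: 'k list \<Rightarrow> 'k \<Rightarrow> 'a. \<forall>\<alpha> \<in> incr_tuples n.
             eq_fin {..<hd \<alpha>} (\<lambda>x. \<Sum>i<n. alt i (\<psi> (del i \<alpha>) x)) (\<phi> \<alpha>))"


subsection \<open>Cech cohomology with coefficients in the sheaf of locally constant functions\<close>

definition locally_constant_on :: "'k::topological_space set \<Rightarrow> ('k \<Rightarrow> 'a) \<Rightarrow> bool" where
  "locally_constant_on S f \<longleftrightarrow>
     (\<forall>x\<in>S. \<exists>N. open N \<and> x \<in> N \<and> (\<forall>y \<in> N \<inter> S. f y = f x))"

text \<open>Open covers are sets of open sets, indexed by themselves; the colimit below is unaffected
  by this, since an indexed cover and its range refine each other.\<close>

definition open_cover :: "'k::topological_space set set \<Rightarrow> bool" where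
  "open_cover \<U> \<longleftrightarrow> (\<forall>U\<in>\<U>. open U) \<and> \<Union>\<U> = UNIV"

definition cover_tuples :: "nat \<Rightarrow> 'k set set \<Rightarrow> 'k set list set" where
  "cover_tuples n \<U> = {s. length s = Suc n \<and> set s \<subseteq> \<U>}"

text \<open>An \<open>n\<close>-cochain assigns to every \<open>(n+1)\<close>-tuple (not necessarily increasing or injective) of
  members of the cover a section over their intersection. Sections are extended by \<open>0\<close>, so that
  equal cochains are equal as HOL functions.\<close>

definition cech_cochains ::
  "nat \<Rightarrow> 'k::topological_space set set \<Rightarrow> ('k set list \<Rightarrow> 'k \<Rightarrow> 'a::ab_group_add) set" where
  "cech_cochains n \<U> =
     {c. (\<forall>s \<in> cover_tuples n \<U>. locally_constant_on (\<Inter>(set s)) (c s)) \<and>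
         (\<forall>s x. \<not> (s \<in> cover_tuples n \<U> \<and> x \<in> \<Inter>(set s)) \<longrightarrow> c s x = 0)}"

definition cech_diff ::
  "nat \<Rightarrow> 'k set set \<Rightarrow> ('k set list \<Rightarrow> 'k \<Rightarrow> 'a::ab_group_add) \<Rightarrow> 'k set list \<Rightarrow> 'k \<Rightarrow> 'a" where
  "cech_diff n \<U> c = (\<lambda>s x.
     if s \<in> cover_tuples (Suc n) \<U> \<and> x \<in> \<Inter>(set s)
     then \<Sum>i\<le>Suc n. alt i (c (del i s) x) else 0)"

definition cech_cocycles ::
  "nat \<Rightarrow> 'k::topological_space set set \<Rightarrow> ('k set list \<Rightarrow> 'k \<Rightarrow> 'a::ab_group_add) set" where
  "cech_cocycles n \<U> = {c \<in> cech_cochains n \<U>. cech_diff n \<U> c = (\<lambda>s x. 0)}"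

definition cech_coboundaries ::
  "nat \<Rightarrow> 'k::topological_space set set \<Rightarrow> ('k set list \<Rightarrow> 'k \<Rightarrow> 'a::ab_group_add) set" where
  "cech_coboundaries n \<U> =
     (case n of 0 \<Rightarrow> {\<lambda>s x. 0} | Suc m \<Rightarrow> cech_diff m \<U> ` cech_cochains m \<U>)"

definition refines_via :: "'k set set \<Rightarrow> ('k set \<Rightarrow> 'k set) \<Rightarrow> 'k set set \<Rightarrow> bool" where
  "refines_via \<V> \<tau> \<U> \<longleftrightarrow> (\<forall>V\<in>\<V>. \<tau> V \<in> \<U> \<and> V \<subseteq> \<tau> V)"

definition cech_pullback ::
  "nat \<Rightarrow> 'k set set \<Rightarrow> ('k set \<Rightarrow> 'k set) \<Rightarrow> ('k set list \<Rightarrow> 'k \<Rightarrow> 'a::ab_group_add)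
     \<Rightarrow> 'k set list \<Rightarrow> 'k \<Rightarrow> 'a" where
  "cech_pullback n \<V> \<tau> c = (\<lambda>s x.
     if s \<in> cover_tuples n \<V> \<and> x \<in> \<Inter>(set s) then c (map \<tau> s) x else 0)"

text \<open>The cohomology group is the colimit over all open covers, directed by refinement: an element
  is represented by a cocycle on some cover, and two representatives are identified if they
  become cohomologous on a common refinement.\<close>

type_synonym ('k, 'a) cech_rep = "'k set set \<times> ('k set list \<Rightarrow> 'k \<Rightarrow> 'a)"

definition cech_reps :: "nat \<Rightarrow> ('k::topological_space, 'a::ab_group_add) cech_rep set" where
  "cech_reps n = {(\<U>, c). open_cover \<U> \<and> c \<in> cech_cocycles n \<U>}"

definition cech_rel ::
  "nat \<Rightarrow> (('k::topological_space, 'a::ab_group_add) cech_rep \<times> ('k, 'a) cech_rep) set" where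
  "cech_rel n = {((\<U>, c), (\<V>, d)).
     (\<U>, c) \<in> cech_reps n \<and> (\<V>, d) \<in> cech_reps n \<and>
     (\<exists>\<W> \<sigma> \<tau>. open_cover \<W> \<and> refines_via \<W> \<sigma> \<U> \<and> refines_via \<W> \<tau> \<V> \<and>
        (\<lambda>s x. cech_pullback n \<W> \<sigma> c s x - cech_pullback n \<W> \<tau> d s x) \<in> cech_coboundaries n \<W>)}"

text \<open>Classes are added by adding representatives pulled back to a common refinement.\<close>

definition cech_cohomology ::
  "nat \<Rightarrow> ('k::topological_space, 'a::ab_group_add) cech_rep set monoid" where
  "cech_cohomology n =
     \<lparr>carrier = cech_reps n // cech_rel n,
      monoid.mult = (\<lambda>X Y. cech_rel n ``
        {(\<W>, \<lambda>s x. cech_pullback n \<W> \<sigma> c s x + cech_pullback n \<W> \<tau> d s x) | \<W> \<sigma> \<tau> \<U> c \<V> d.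
           (\<U>, c) \<in> X \<and> (\<V>, d) \<in> Y \<and>
           open_cover \<W> \<and> refines_via \<W> \<sigma> \<U> \<and> refines_via \<W> \<tau> \<V>}),
      one = cech_rel n `` {({UNIV}, \<lambda>s x. 0)}\<rparr>"

end

theory Submission
  imports Defs
begin

text \<open>Both halves cone off at infinity. Homogeneous sets for a lexicographic colouring yield a filter
  along which any family of functions \<open>f \<gamma> l : \<kappa> \<rightarrow> A\<close>, indexed by \<open>\<gamma> < \<kappa>\<close> and finite lists \<open>l\<close> over
  \<open>\<kappa>\<close>, converges in the strong sense that each restriction to a proper initial segment is
  eventually constant in \<open>\<gamma>\<close>. Up to sign, the limit of \<open>\<phi>\<close> at \<open>\<beta> @ [\<gamma>]\<close> as \<open>\<gamma> \<rightarrow> \<kappa>\<close> trivialises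
  an \<open>n\<close>-coherent \<open>\<phi>\<close>, because coherence at \<open>\<alpha> @ [\<gamma>]\<close> involves only finitely many of these limits.
  For Cech cohomology, every open cover has members containing \<open>{\<beta><..\<alpha>}\<close> for one fixed \<open>\<beta>\<close> and
  all \<open>\<alpha> > \<beta>\<close>, and below \<open>\<beta>\<close> a locally constant choice of members exists; the cone towards these
  members bounds every cocycle on a subcover.\<close>

section \<open>Size and regularity of a weakly compact cardinal\<close>

text \<open>A cardinal order has least order type among the well-orders of its universe, so no
  proper initial segment is equipollent with the whole.\<close>

lemma lessThan_lesspoll:
  includes cardinal_syntax
  fixes a :: "'k::wellorder"
  assumes "card_order {(x::'k, y). x \<le> y}"
  shows "{..<a} \<prec> (UNIV :: 'k set)"
proof -
  let ?r = "{(x::'k, y). x \<le> y}"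
  have "underS ?r a = {..<a}"
    by (auto simp: underS_def)
  moreover have "|underS ?r a| <o ?r"
    using assms card_order_on_Card_order[of UNIV ?r] by (intro card_of_underS) auto
  moreover have "?r =o |UNIV :: 'k set|"
    using assms card_of_unique ordIso_symmetric by blast
  ultimately have "|{..<a}| <o |UNIV :: 'k set|"
    by (metis ordLess_ordIso_trans)
  then have "\<not> |UNIV :: 'k set| \<le>o |{..<a}|"
    using not_ordLeq_ordLess by blast
  then have "\<not> (UNIV :: 'k set) \<lesssim> {..<a}"
    by (simp add: lepoll_def flip: card_of_ordLeq)
  then show ?thesis
    by (metis eqpoll_imp_lepoll eqpoll_sym lesspoll_def subset_UNIV subset_imp_lepoll)
qed

context
  assumes wc: "weakly_compact TYPE('k::wellorder)"
begin

lemma infinite_UNIV_wc: "infinite (UNIV :: 'k set)"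
  using wc by (auto simp: weakly_compact_def countable_finite)

lemma initial_lesspoll: "{..<a::'k} \<prec> (UNIV :: 'k set)"
  using wc lessThan_lesspoll by (auto simp: weakly_compact_def)

text \<open>A greatest element would leave an initial segment one point short of the infinite
  universe, hence equipollent with it.\<close>

lemma ex_greater: "\<exists>b::'k. a < b"
proof (rule ccontr)
  assume "\<nexists>b. a < b"
  then have "(UNIV :: 'k set) = insert a {..<a}"
    by (auto simp: not_less order_le_less)
  moreover have "infinite {..<a}"
    using calculation infinite_UNIV_wc by (metis finite_insert)
  ultimately have "(UNIV :: 'k set) \<approx> {..<a}"
    by (metis infinite_insert_eqpoll)
  then show False
    using initial_lesspoll[of a] by (simp add: lesspoll_def eqpoll_sym)
qed

lemma bounded_lesspoll:
  assumes "S \<subseteq> {..a::'k}"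
  shows "S \<prec> (UNIV :: 'k set)"
proof -
  obtain b where "a < b"
    using ex_greater by blast
  with assms have "S \<subseteq> {..<b}"
    by fastforce
  then show ?thesis
    using initial_lesspoll lesspoll_trans1 subset_imp_lepoll by blast
qed

lemma eqpoll_unbounded:
  assumes "S \<approx> (UNIV :: 'k set)"
  shows "\<exists>b\<in>S. (a::'k) < b"
proof (rule ccontr)
  assume "\<not> ?thesis"
  then have "S \<subseteq> {..a}"
    by (auto simp: not_less)
  with assms show False
    using bounded_lesspoll lesspoll_def by blast
qed

text \<open>The partition relation colours unordered pairs; \<open>Min\<close> and
  \<open>Max\<close> recover their order, so any binary relation becomes a colouring.\<close>

lemma homogeneous_set:
  fixes P :: "'k \<Rightarrow> 'k \<Rightarrow> bool"
  obtains H where "H \<approx> (UNIV :: 'k set)"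
    "(\<forall>x\<in>H. \<forall>y\<in>H. x < y \<longrightarrow> P x y) \<or> (\<forall>x\<in>H. \<forall>y\<in>H. x < y \<longrightarrow> \<not> P x y)"
proof -
  obtain H i where H: "H \<approx> (UNIV :: 'k set)"
    and i: "(\<lambda>S. P (Min S) (Max S)) ` nsets H 2 \<subseteq> {i}"
    using wc unfolding weakly_compact_def by metis
  have "P x y = i" if "x \<in> H" "y \<in> H" "x < y" for x y
  proof -
    have "{x, y} \<in> nsets H 2"
      using that by auto
    then have "P (Min {x, y}) (Max {x, y}) = i"
      using i by blast
    with \<open>x < y\<close> show ?thesis
      by (simp add: min_absorb1 max_absorb2)
  qed
  with H show thesis
    by (intro that[of H]) auto
qed

text \<open>Colour pairs by equality under \<open>g\<close>: if the values on a homogeneous set were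
  distinct, \<kappa> would inject into the small range.\<close>

lemma ex_large_fibre:
  fixes g :: "'k \<Rightarrow> 'b"
  assumes "range g \<prec> (UNIV :: 'k set)"
  shows "\<exists>y. \<forall>a. \<exists>b>a. g b = y"
proof -
  obtain H where H: "H \<approx> (UNIV :: 'k set)"
    and hom: "(\<forall>x\<in>H. \<forall>y\<in>H. x < y \<longrightarrow> g x = g y) \<or> (\<forall>x\<in>H. \<forall>y\<in>H. x < y \<longrightarrow> g x \<noteq> g y)"
    using homogeneous_set[of "\<lambda>x y. g x = g y"] .
  from hom show ?thesis
  proof
    assume *: "\<forall>x\<in>H. \<forall>y\<in>H. x < y \<longrightarrow> g x = g y"
    obtain h where "h \<in> H"
      using eqpoll_unbounded[OF H] by blast
    have "\<exists>b>a. g b = g h" for a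
    proof -
      obtain b where "b \<in> H" "max a h < b"
        using eqpoll_unbounded[OF H] by blast
      with * \<open>h \<in> H\<close> show ?thesis
        by (metis max_less_iff_conj)
    qed
    then show ?thesis
      by blast
  next
    assume "\<forall>x\<in>H. \<forall>y\<in>H. x < y \<longrightarrow> g x \<noteq> g y"
    then have "inj_on g H"
      by (metis (no_types, lifting) inj_onI linorder_neqE)
    then have "H \<lesssim> range g"
      unfolding lepoll_def by blast
    with assms have "H \<prec> (UNIV :: 'k set)"
      using lesspoll_trans1 by blast
    with H show ?thesis
      by (simp add: lesspoll_def)
  qed
qed

text \<open>This is regularity of \<kappa>. Otherwise each \<open>a\<close> has a point
  \<open>g a\<close> of \<open>S\<close> with image at least \<open>a\<close>; some point is chosen
  for cofinally many \<open>a\<close>, which its single image cannot dominate.\<close>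

lemma lesspoll_image_bounded:
  fixes f :: "'b \<Rightarrow> 'k"
  assumes "S \<prec> (UNIV :: 'k set)"
  shows "\<exists>a. \<forall>x\<in>S. f x < a"
proof (rule ccontr)
  assume "\<not> ?thesis"
  then have "\<forall>a. \<exists>x\<in>S. a \<le> f x"
    by (auto simp: not_less)
  then obtain g where g: "\<And>a. g a \<in> S" "\<And>a. a \<le> f (g a)"
    by metis
  then have "range g \<prec> (UNIV :: 'k set)"
    by (intro lesspoll_trans1[OF subset_imp_lepoll assms]) auto
  then obtain y where y: "\<forall>a. \<exists>b>a. g b = y"
    using ex_large_fibre by blast
  then obtain b where "b > f y" "g b = y"
    by blast
  with g(2)[of b] show False
    by simp
qed

section \<open>Stabilisation of families and limits along a filter\<close>

text \<open>Lets one ordinal index both arguments of a family, which thus becomes a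
  \<kappa>-sequence of \<kappa>-sequences.\<close>

lemma inj_list_prod:
  includes cardinal_syntax
  shows "\<exists>e :: 'k list \<times> 'k \<Rightarrow> 'k. inj e"
proof -
  have "|UNIV \<times> UNIV :: ('k \<times> 'k) set| =o |UNIV :: 'k set|"
    using infinite_UNIV_wc by (rule card_of_Times_same_infinite)
  then obtain p :: "'k \<times> 'k \<Rightarrow> 'k" where p: "inj p"
    by (metis UNIV_Times_UNIV bij_betw_def card_of_ordIso)
  obtain a b :: 'k where "a \<noteq> b"
    using ex_greater by (metis less_irrefl)
  \<comment> \<open>The distinct tags \<open>a\<close> and \<open>b\<close> tell the empty list from
    a nonempty one.\<close>
  define code where "code = rec_list (p (a, a)) (\<lambda>x _ r. p (b, p (x, r)))"
  have code: "code xs = code ys \<Longrightarrow> xs = ys" for xs ys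
  proof (induction xs arbitrary: ys)
    case Nil
    then show ?case
      using \<open>a \<noteq> b\<close> by (cases ys) (auto simp: code_def inj_eq[OF p])
  next
    case (Cons x xs)
    then show ?case
      using \<open>a \<noteq> b\<close> by (cases ys) (auto simp: code_def inj_eq[OF p])
  qed
  have "inj (\<lambda>(xs, x). p (code xs, x))"
    using code by (auto simp: inj_def inj_eq[OF p])
  then show ?thesis
    by blast
qed

text \<open>Sierpinski's argument: along a set homogeneous for the lexicographic comparison, each
  coordinate is eventually monotone once the earlier ones have settled, hence eventually
  constant, because it takes fewer than \<open>\<kappa>\<close> values.\<close>

lemma lex_stabilises:
  fixes s :: "'k \<Rightarrow> 'k \<Rightarrow> 'k"
  assumes small: "B \<prec> (UNIV :: 'k set)" and B: "\<And>\<gamma> \<eta>. s \<gamma> \<eta> \<in> B"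
  obtains H where "H \<approx> (UNIV :: 'k set)"
    "\<And>\<eta>. \<exists>c. \<forall>\<gamma>\<in>H. \<forall>\<delta>\<in>H. c \<le> \<gamma> \<longrightarrow> c \<le> \<delta> \<longrightarrow> s \<gamma> \<eta> = s \<delta> \<eta>"
proof -
  \<comment> \<open>\<open>P\<close> is the strict lexicographic order on the sequences
    \<open>s \<gamma>\<close>, decided at their first difference.\<close>
  define P where "P \<gamma> \<delta> \<longleftrightarrow> (\<exists>\<eta>. (\<forall>\<zeta><\<eta>. s \<gamma> \<zeta> = s \<delta> \<zeta>) \<and> s \<gamma> \<eta> < s \<delta> \<eta>)" for \<gamma> \<delta>
  obtain H where H: "H \<approx> (UNIV :: 'k set)"
    and hom: "(\<forall>x\<in>H. \<forall>y\<in>H. x < y \<longrightarrow> P x y) \<or> (\<forall>x\<in>H. \<forall>y\<in>H. x < y \<longrightarrow> \<not> P x y)"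
    using homogeneous_set[of P] .
  obtain nxt where nxt: "\<And>a. nxt a \<in> H" "\<And>a. a < nxt a"
    using eqpoll_unbounded[OF H] by metis
  have "\<exists>c. \<forall>\<gamma>\<in>H. \<forall>\<delta>\<in>H. c \<le> \<gamma> \<longrightarrow> c \<le> \<delta> \<longrightarrow> s \<gamma> \<eta> = s \<delta> \<eta>" for \<eta>
  proof (induction \<eta> rule: less_induct)
    case (less \<eta>)
    then obtain c where c: "\<And>\<zeta> \<gamma> \<delta>. \<lbrakk>\<zeta> < \<eta>; \<gamma> \<in> H; \<delta> \<in> H; c \<zeta> \<le> \<gamma>; c \<zeta> \<le> \<delta>\<rbrakk> \<Longrightarrow> s \<gamma> \<zeta> = s \<delta> \<zeta>"
      by metis
    \<comment> \<open>There are fewer than \<kappa> coordinates below \<eta>, so regularity bounds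
      their settling points.\<close>
    obtain a where a: "\<And>\<zeta>. \<zeta> < \<eta> \<Longrightarrow> c \<zeta> < a"
      using lesspoll_image_bounded[OF initial_lesspoll[of \<eta>], of c] by blast
    have agree: "s \<gamma> \<zeta> = s \<delta> \<zeta>" if "\<zeta> < \<eta>" "\<gamma> \<in> H" "\<delta> \<in> H" "a \<le> \<gamma>" "a \<le> \<delta>" for \<zeta> \<gamma> \<delta>
      using c[of \<zeta> \<gamma> \<delta>] a[of \<zeta>] that by fastforce
    have P_iff: "P \<gamma> \<delta> \<longleftrightarrow> s \<gamma> \<eta> < s \<delta> \<eta>"
      if "\<gamma> \<in> H" "\<delta> \<in> H" "a \<le> \<gamma>" "a \<le> \<delta>" "s \<gamma> \<eta> \<noteq> s \<delta> \<eta>" for \<gamma> \<delta>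
    proof
      assume "P \<gamma> \<delta>"
      then obtain \<eta>' where \<eta>': "\<forall>\<zeta><\<eta>'. s \<gamma> \<zeta> = s \<delta> \<zeta>" "s \<gamma> \<eta>' < s \<delta> \<eta>'"
        unfolding P_def by blast
      have "\<eta>' = \<eta>"
        using \<eta>' agree[of \<eta>' \<gamma> \<delta>] that by (metis less_irrefl linorder_neqE)
      with \<eta>' show "s \<gamma> \<eta> < s \<delta> \<eta>"
        by simp
    qed (use agree that in \<open>auto simp: P_def\<close>)
    have "range (\<lambda>b. s (nxt b) \<eta>) \<prec> (UNIV :: 'k set)"
      by (rule lesspoll_trans1[OF subset_imp_lepoll small]) (use B in auto)
    \<comment> \<open>The eventual value of coordinate \<eta> can only be one taken cofinally often;
      smallness of \<open>B\<close> provides it.\<close>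
    from ex_large_fibre[OF this] obtain y where y: "\<And>a. \<exists>b>a. s (nxt b) \<eta> = y"
      by blast
    then obtain b where b: "a < b" "s (nxt b) \<eta> = y"
      by blast
    have "s \<gamma> \<eta> = y" if "\<gamma> \<in> H" "nxt b \<le> \<gamma>" for \<gamma>
    proof (rule ccontr)
      assume "s \<gamma> \<eta> \<noteq> y"
      obtain d where d: "\<gamma> < d" "s (nxt d) \<eta> = y"
        using y by blast
      have *: "a \<le> nxt b" "a \<le> \<gamma>" "a \<le> nxt d" "nxt b < \<gamma>" "\<gamma> < nxt d"
        using that b d nxt(2)[of d] nxt(2)[of b] \<open>s \<gamma> \<eta> \<noteq> y\<close>
        by (auto simp: order.strict_iff_order)
      have "P (nxt b) \<gamma> \<longleftrightarrow> y < s \<gamma> \<eta>" "P \<gamma> (nxt d) \<longleftrightarrow> s \<gamma> \<eta> < y"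
        using P_iff[of "nxt b" \<gamma>] P_iff[of \<gamma> "nxt d"] * b d nxt(1) \<open>s \<gamma> \<eta> \<noteq> y\<close> \<open>\<gamma> \<in> H\<close>
        by simp_all
      \<comment> \<open>Leaving \<open>y\<close> at \<gamma> and returning to it at
        \<open>nxt d\<close> takes one rise and one fall, but homogeneity answers both comparisons
        alike.\<close>
      moreover have "P (nxt b) \<gamma> \<longleftrightarrow> P \<gamma> (nxt d)"
        using hom * nxt(1) \<open>\<gamma> \<in> H\<close> by blast
      ultimately show False
        using \<open>s \<gamma> \<eta> \<noteq> y\<close> by auto
    qed
    then show ?case
      by (metis (no_types))
  qed
  with H show thesis
    using that by blast
qed

text \<open>With values and arguments injected into \<kappa>, one homogeneous set serves all lists
  \<open>l\<close>; regularity makes convergence uniform on each initial segment. A filter lets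
  finitely many limits be attained at a common \<gamma>.\<close>

lemma limit_filter:
  fixes f :: "'k \<Rightarrow> 'k list \<Rightarrow> 'k \<Rightarrow> 'a"
  assumes "(UNIV :: 'a set) \<prec> (UNIV :: 'k set)"
  obtains F :: "'k filter" and t where "F \<noteq> bot" "F \<le> at_top"
    "\<And>l \<zeta>. \<forall>\<^sub>F \<gamma> in F. \<forall>x<\<zeta>. f \<gamma> l x = t l x"
proof -
  obtain j :: "'a \<Rightarrow> 'k" where j: "inj j"
    using assms by (auto simp: lesspoll_def lepoll_def)
  obtain e :: "'k list \<times> 'k \<Rightarrow> 'k" where e: "inj e"
    using inj_list_prod by blast
  \<comment> \<open>An \<eta> outside the range of \<open>e\<close> reads an arbitrary entry; only
    coordinates \<open>e (l, x)\<close> are consulted later.\<close>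
  define s where "s \<gamma> \<eta> = j (case inv_into UNIV e \<eta> of (l, x) \<Rightarrow> f \<gamma> l x)" for \<gamma> \<eta>
  have s_e: "s \<gamma> (e (l, x)) = j (f \<gamma> l x)" for \<gamma> l x
    by (simp add: s_def e)
  have "range j \<prec> (UNIV :: 'k set)"
    using assms j by simp
  then obtain H where H: "H \<approx> (UNIV :: 'k set)"
    and stab: "\<And>\<eta>. \<exists>c. \<forall>\<gamma>\<in>H. \<forall>\<delta>\<in>H. c \<le> \<gamma> \<longrightarrow> c \<le> \<delta> \<longrightarrow> s \<gamma> \<eta> = s \<delta> \<eta>"
    by (rule lex_stabilises[of "range j" s]) (auto simp: s_def)
  have "\<exists>c. \<forall>\<gamma>\<in>H. \<forall>\<delta>\<in>H. c \<le> \<gamma> \<longrightarrow> c \<le> \<delta> \<longrightarrow> f \<gamma> l x = f \<delta> l x" for l x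
    using stab[of "e (l, x)"] by (simp add: s_e inj_eq[OF j])
  then obtain c where c: "\<And>l x \<gamma> \<delta>. \<lbrakk>\<gamma> \<in> H; \<delta> \<in> H; c l x \<le> \<gamma>; c l x \<le> \<delta>\<rbrakk> \<Longrightarrow> f \<gamma> l x = f \<delta> l x"
    by metis
  obtain nxt where nxt: "\<And>a. nxt a \<in> H" "\<And>a. a < nxt a"
    using eqpoll_unbounded[OF H] by metis
  define t where "t l x = f (nxt (c l x)) l x" for l x
  define F where "F = inf at_top (principal H)"
  have F: "eventually Q F \<longleftrightarrow> (\<exists>a. \<forall>\<gamma>\<in>H. a \<le> \<gamma> \<longrightarrow> Q \<gamma>)" for Q
    by (auto simp: F_def eventually_inf_principal eventually_at_top_linorder)
  show thesis
  proof
    show "F \<noteq> bot"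
      using nxt by (auto simp: trivial_limit_def F intro!: less_imp_le)
    show "F \<le> at_top"
      by (simp add: F_def)
    show "\<forall>\<^sub>F \<gamma> in F. \<forall>x<\<zeta>. f \<gamma> l x = t l x" for l \<zeta>
    proof -
      obtain a where a: "\<And>x. x < \<zeta> \<Longrightarrow> c l x < a"
        using lesspoll_image_bounded[OF initial_lesspoll[of \<zeta>], of "c l"] by blast
      have "f \<gamma> l x = t l x" if "\<gamma> \<in> H" "a \<le> \<gamma>" "x < \<zeta>" for \<gamma> x
        unfolding t_def using that a[of x] nxt(1) nxt(2)[of "c l x"] by (intro c) auto
      then show ?thesis
        unfolding F by blast
    qed
  qed
qed

end

section \<open>Alternating sums over cones\<close>

text \<open>Solving an alternating relation for its last term costs the sign
  \<open>alt (Suc n)\<close>; this is the sign built into the limits \<open>\<psi>\<close>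
  below.\<close>

lemma alt_cancel:
  fixes b :: "'a::ab_group_add"
  assumes "(\<Sum>i<n. alt i (a i)) + alt n b = 0"
  shows "(\<Sum>i<n. alt i (alt (Suc n) (a i))) = b"
proof -
  have "(\<Sum>i<n. alt i (alt (Suc n) (a i))) = alt (Suc n) (\<Sum>i<n. alt i (a i))"
    by (auto simp: alt_def sum_negf[symmetric] intro!: sum.cong)
  also have "(\<Sum>i<n. alt i (a i)) = - alt n b"
    using assms by (simp add: eq_neg_iff_add_eq_0)
  also have "alt (Suc n) (- alt n b) = b"
    by (simp add: alt_def)
  finally show ?thesis .
qed

lemma length_del: "i < length s \<Longrightarrow> length (del i s) = length s - 1"
  by (simp add: del_def)

lemma set_del_subset: "set (del i s) \<subseteq> set s"
  by (auto simp: del_def dest: in_set_takeD in_set_dropD)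

lemma map_del: "map f (del i s) = del i (map f s)"
  by (simp add: del_def take_map drop_map)

lemma del_append_last: "i < length s \<Longrightarrow> del i (s @ [x]) = del i s @ [x]"
  by (simp add: del_def)

lemma del_length_append: "del (length s) (s @ [x]) = s"
  by (simp add: del_def)

text \<open>The boundary of a cone: deleting an entry of \<open>s\<close> gives the cone over a
  face, deleting the apex \<open>x\<close> gives back \<open>s\<close>.\<close>

lemma sum_del_append_last:
  assumes "length s = n"
  shows "(\<Sum>i\<le>n. alt i (c (del i (s @ [x])))) = (\<Sum>i<n. alt i (c (del i s @ [x]))) + alt n (c s)"
proof -
  have "(\<Sum>i\<le>n. alt i (c (del i (s @ [x])))) =
      (\<Sum>i<n. alt i (c (del i (s @ [x])))) + alt n (c (del n (s @ [x])))"
    by (simp add: lessThan_Suc flip: lessThan_Suc_atMost)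
  also have "(\<Sum>i<n. alt i (c (del i (s @ [x])))) = (\<Sum>i<n. alt i (c (del i s @ [x])))"
    using assms by (intro sum.cong) (auto simp: del_append_last)
  finally show ?thesis
    using assms del_length_append[of s x] by simp
qed

section \<open>Coherent families are trivial\<close>

lemma n_coherent_imp_n_trivial:
  fixes \<phi> :: "'k::wellorder list \<Rightarrow> 'k \<Rightarrow> 'a::ab_group_add"
  assumes wc: "weakly_compact TYPE('k)" and "n > 0"
    and small: "(UNIV :: 'a set) \<prec> (UNIV :: 'k set)"
    and coh: "n_coherent n \<phi>"
  shows "n_trivial n \<phi>"
proof -
  obtain F :: "'k filter" and t where F: "F \<noteq> bot" "F \<le> at_top"
    and t: "\<And>l \<zeta>. \<forall>\<^sub>F \<gamma> in F. \<forall>x<\<zeta>. \<phi> (l @ [\<gamma>]) x = t l x"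
    by (rule limit_filter[OF wc small, of "\<lambda>\<gamma> l. \<phi> (l @ [\<gamma>])"]) (rule that)
  define \<psi> where "\<psi> l x = alt (Suc n) (t l x)" for l x
  have *: "eq_fin {..<hd \<alpha>} (\<lambda>x. \<Sum>i<n. alt i (\<psi> (del i \<alpha>) x)) (\<phi> \<alpha>)" if \<alpha>: "\<alpha> \<in> incr_tuples n" for \<alpha>
  proof -
    have "\<forall>\<^sub>F \<gamma> in F. y < \<gamma>" for y
    proof -
      obtain b where "y < b"
        using ex_greater[OF wc] by blast
      then have "\<forall>\<^sub>F \<gamma> in at_top. y < \<gamma>"
        unfolding eventually_at_top_linorder by (meson less_le_trans)
      then show ?thesis
        using filter_leD[OF F(2)] by blast
    qed
    then have "\<forall>\<^sub>F \<gamma> in F. \<forall>y\<in>set \<alpha>. y < \<gamma>"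
      by (intro eventually_ball_finite) auto
    moreover have "\<forall>\<^sub>F \<gamma> in F. \<forall>i\<in>{..<n}. \<forall>x<hd \<alpha>. \<phi> (del i \<alpha> @ [\<gamma>]) x = t (del i \<alpha>) x"
      using t by (intro eventually_ball_finite) auto
    ultimately have "\<forall>\<^sub>F \<gamma> in F. (\<forall>y\<in>set \<alpha>. y < \<gamma>) \<and>
        (\<forall>i\<in>{..<n}. \<forall>x<hd \<alpha>. \<phi> (del i \<alpha> @ [\<gamma>]) x = t (del i \<alpha>) x)"
      by (rule eventually_conj)
    \<comment> \<open>One \<gamma> now stands in for the limit: it lies above \<alpha>, and all
      \<open>n\<close> faces have reached their limits at it on the whole domain
      \<open>{..<hd \<alpha>}\<close>.\<close>
    from eventually_happens'[OF F(1) this]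
    obtain \<gamma> where \<gamma>: "\<And>y. y \<in> set \<alpha> \<Longrightarrow> y < \<gamma>"
      and lim: "\<And>i x. i < n \<Longrightarrow> x < hd \<alpha> \<Longrightarrow> \<phi> (del i \<alpha> @ [\<gamma>]) x = t (del i \<alpha>) x"
      by blast
    have len: "length \<alpha> = n" and incr: "\<alpha> @ [\<gamma>] \<in> incr_tuples (Suc n)"
      using \<alpha> \<gamma> by (auto simp: incr_tuples_def sorted_wrt_append)
    have hd: "hd (\<alpha> @ [\<gamma>]) = hd \<alpha>"
      using len \<open>n > 0\<close> by (cases \<alpha>) auto
    \<comment> \<open>As \<gamma> does not vary with \<open>x\<close>, the only exceptional points
      are the finitely many where coherence at \<open>\<alpha> @ [\<gamma>]\<close> fails.\<close>
    have fin: "finite {x\<in>{..<hd \<alpha>}. (\<Sum>i\<le>n. alt i (\<phi> (del i (\<alpha> @ [\<gamma>])) x)) \<noteq> 0}"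
      using bspec[OF coh[unfolded n_coherent_def] incr] unfolding eq_fin_def hd .
    have "(\<Sum>i<n. alt i (\<psi> (del i \<alpha>) x)) = \<phi> \<alpha> x"
      if "x < hd \<alpha>" "(\<Sum>i\<le>n. alt i (\<phi> (del i (\<alpha> @ [\<gamma>])) x)) = 0" for x
    proof -
      have "(\<Sum>i<n. alt i (\<psi> (del i \<alpha>) x)) = (\<Sum>i<n. alt i (alt (Suc n) (\<phi> (del i \<alpha> @ [\<gamma>]) x)))"
        using lim that(1) by (intro sum.cong) (auto simp: \<psi>_def)
      also have "\<dots> = \<phi> \<alpha> x"
        using that(2) sum_del_append_last[OF len, of "\<lambda>s. \<phi> s x" \<gamma>] by (intro alt_cancel) simp
      finally show ?thesis .
    qed
    then show ?thesis
      unfolding eq_fin_def by (intro finite_subset[OF _ fin]) auto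
  qed
  show ?thesis
  proof (cases "n = 1")
    case True
    \<comment> \<open>The only face of a one-entry tuple is the empty list, so
      \<open>\<psi> []\<close> is the single function sought.\<close>
    have "eq_fin {..<\<beta>} (\<psi> []) (\<phi> [\<beta>])" for \<beta>
      using *[of "[\<beta>]"] True by (simp add: incr_tuples_def alt_def del_def)
    with True show ?thesis
      by (auto simp: n_trivial_def)
  next
    case False
    with * show ?thesis
      by (auto simp: n_trivial_def)
  qed
qed

section \<open>Open covers in the order topology and cones over cocycles\<close>

context
  assumes wc: "weakly_compact TYPE('k::{wellorder, linorder_topology})"
begin

text \<open>Each point has an immediate successor \<open>b\<close>, and \<open>{..a}\<close> is the
  open segment below it.\<close>

lemma open_atMost_wc: "open {..a::'k}"
proof -
  define b where "b = (LEAST b. a < b)"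
  have "a < b"
    unfolding b_def using ex_greater[OF wc] by (rule LeastI_ex)
  moreover have "\<not> a < y" if "y < b" for y
    using that not_less_Least unfolding b_def by blast
  ultimately have "{..a} = {..<b}"
    by (auto simp: not_less)
  then show ?thesis
    by simp
qed

lemma open_greaterThanAtMost_wc: "open {a<..b::'k}"
  using open_Int[OF open_greaterThan[of a] open_atMost_wc[of b]]
  by (simp add: greaterThanAtMost_def)

text \<open>Otherwise every \<beta> has a \<open>g \<beta>\<close> such that no member covers
  \<open>{\<beta><..g \<beta>}\<close>. A point closed under \<open>g\<close>, reached as a supremum
  of countably many steps, lies in a member that does cover such an interval.\<close>

lemma open_cover_tail:
  assumes "open_cover (\<U> :: 'k set set)"
  shows "\<exists>\<beta>. \<forall>\<alpha>>\<beta>. \<exists>V\<in>\<U>. {\<beta><..\<alpha>} \<subseteq> V"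
proof (rule ccontr)
  assume "\<not> ?thesis"
  then obtain g where g: "\<And>\<beta> V. V \<in> \<U> \<Longrightarrow> \<not> {\<beta><..g \<beta>} \<subseteq> V"
    by metis
  have "\<exists>c. \<forall>\<beta>\<in>{..b}. g \<beta> < c" for b
    using lesspoll_image_bounded[OF wc bounded_lesspoll[OF wc subset_refl]] .
  then obtain h where h: "\<And>b \<beta>. \<beta> \<le> b \<Longrightarrow> g \<beta> < h b"
    by (metis atMost_iff)
  \<comment> \<open>The start \<open>undefined\<close> is an arbitrary ordinal.\<close>
  define \<nu> where "\<nu> i = (h ^^ i) undefined" for i
  have "(UNIV :: nat set) \<lesssim> (UNIV :: 'k set)"
    using infinite_UNIV_wc[OF wc] by (simp add: infinite_le_lepoll)
  moreover have "\<not> (UNIV :: nat set) \<approx> (UNIV :: 'k set)"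
    using wc countable_eqpoll[of "UNIV :: nat set" "UNIV :: 'k set"] eqpoll_sym
    by (auto simp: weakly_compact_def)
  ultimately have "(UNIV :: nat set) \<prec> (UNIV :: 'k set)"
    by (simp add: lepoll_iff_leqpoll)
  from lesspoll_image_bounded[OF wc this, of \<nu>] obtain m where m: "\<forall>i. \<nu> i < m"
    by auto
  define l where "l = (LEAST l. \<forall>i. \<nu> i < l)"
  have l: "\<nu> i < l" for i
    unfolding l_def using LeastI[of "\<lambda>l. \<forall>i. \<nu> i < l", OF m] by blast
  obtain V where V: "V \<in> \<U>" "open V" "l \<in> V"
    using assms unfolding open_cover_def by (metis UNIV_I UnionE)
  \<comment> \<open>Since \<open>\<nu> 0\<close> lies below \<open>l\<close>, an open set around
    \<open>l\<close> contains an interval to its left.\<close>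
  obtain b where b: "b < l" "{b<..l} \<subseteq> V"
    using open_left[OF V(2,3) l[of 0]] by blast
  obtain i where "b \<le> \<nu> i"
    using not_less_Least[of b "\<lambda>l. \<forall>i. \<nu> i < l"] b(1) by (auto simp: l_def[symmetric] not_less)
  then have "g b < \<nu> (Suc i)"
    using h by (simp add: \<nu>_def)
  with l[of "Suc i"] b(2) have "{b<..g b} \<subseteq> V"
    by force
  with g V(1) show False
    by blast
qed

text \<open>A member at \<beta> covers some \<open>{\<gamma><..\<beta>}\<close> and extends the
  choice made on \<open>{..\<gamma>}\<close>. Confining neighbourhoods to the initial segment keeps
  them from crossing the seam in the next step.\<close>

lemma locally_constant_choice:
  assumes U: "open_cover (\<U> :: 'k set set)"
  shows "\<exists>u. \<forall>x\<le>\<beta>. x \<in> u x \<and> u x \<in> \<U> \<and>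
    (\<exists>N. open N \<and> x \<in> N \<and> N \<subseteq> {..\<beta>} \<and> (\<forall>y\<in>N. u y = u x))"
proof (induction \<beta> rule: less_induct)
  case (less \<beta>)
  obtain V where V: "V \<in> \<U>" "open V" "\<beta> \<in> V"
    using U unfolding open_cover_def by (metis UNIV_I UnionE)
  show ?case
  proof (cases "\<exists>y. y < \<beta>")
    case False
    then have "{..\<beta>} = {\<beta>}"
      by (auto simp: order_le_less)
    with V show ?thesis
      using open_atMost_wc[of \<beta>] by (intro exI[of _ "\<lambda>_. V"]) auto
  next
    case True
    then obtain \<gamma> where \<gamma>: "\<gamma> < \<beta>" "{\<gamma><..\<beta>} \<subseteq> V"
      using open_left[OF V(2,3)] by blast
    from less.IH[OF \<gamma>(1)] obtain u where u: "\<And>x. x \<le> \<gamma> \<Longrightarrow> x \<in> u x \<and> u x \<in> \<U> \<and>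
        (\<exists>N. open N \<and> x \<in> N \<and> N \<subseteq> {..\<gamma>} \<and> (\<forall>y\<in>N. u y = u x))"
      by blast
    define v where "v x = (if x \<le> \<gamma> then u x else V)" for x
    have "x \<in> v x \<and> v x \<in> \<U> \<and> (\<exists>N. open N \<and> x \<in> N \<and> N \<subseteq> {..\<beta>} \<and> (\<forall>y\<in>N. v y = v x))"
      if "x \<le> \<beta>" for x
    proof (cases "x \<le> \<gamma>")
      case True
      with u[OF True] obtain N where N: "open N" "x \<in> N" "N \<subseteq> {..\<gamma>}" "\<forall>y\<in>N. u y = u x"
        by blast
      moreover have "N \<subseteq> {..\<beta>}"
        using N(3) \<gamma>(1) by fastforce
      moreover have "\<forall>y\<in>N. v y = v x"
        using N(3,4) True unfolding v_def by (metis atMost_iff subsetD)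
      moreover have "v x = u x"
        using True by (simp add: v_def)
      ultimately show ?thesis
        using u[OF True] by metis
    next
      case False
      with \<gamma> V that show ?thesis
        by (auto simp: v_def intro!: exI[of _ "{\<gamma><..\<beta>}"] open_greaterThanAtMost_wc)
    qed
    then show ?thesis
      by blast
  qed
qed

text \<open>Only the members \<open>e \<alpha>\<close> of the cover are kept, so that tuples of the subcover are indexed by
  lists over \<open>\<kappa>\<close>. The cochain is the limit, as \<open>\<gamma>\<close> tends to \<open>\<kappa>\<close>, of the cone with apex \<open>E \<gamma>\<close>,
  which near each point is eventually a single member of the cover.\<close>

lemma cech_cocycle_bounds_on_subcover:
  fixes c :: "'k set list \<Rightarrow> 'k \<Rightarrow> 'a::ab_group_add"
  assumes small: "(UNIV :: 'a set) \<prec> (UNIV :: 'k set)" and "n > 0"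
    and U: "open_cover \<U>" and c: "c \<in> cech_cocycles n \<U>"
  shows "\<exists>\<W>\<subseteq>\<U>. open_cover \<W> \<and> cech_pullback n \<W> id c \<in> cech_coboundaries n \<W>"
proof -
  obtain m where n: "n = Suc m"
    using \<open>n > 0\<close> by (cases n) auto
  obtain \<beta> where "\<forall>\<alpha>>\<beta>. \<exists>V\<in>\<U>. {\<beta><..\<alpha>} \<subseteq> V"
    using open_cover_tail[OF U] by blast
  then obtain V where V: "\<And>\<alpha>. \<beta> < \<alpha> \<Longrightarrow> V \<alpha> \<in> \<U>" "\<And>\<alpha>. \<beta> < \<alpha> \<Longrightarrow> {\<beta><..\<alpha>} \<subseteq> V \<alpha>"
    by metis
  obtain u where u: "\<And>x. x \<le> \<beta> \<Longrightarrow> x \<in> u x \<and> u x \<in> \<U> \<and>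
      (\<exists>N. open N \<and> x \<in> N \<and> N \<subseteq> {..\<beta>} \<and> (\<forall>y\<in>N. u y = u x))"
    using locally_constant_choice[OF U, of \<beta>] by blast
  \<comment> \<open>\<open>e\<close> assigns to each ordinal a member containing it: the local
    choice up to \<beta>, a tail member beyond.\<close>
  define e where "e \<alpha> = (if \<alpha> \<le> \<beta> then u \<alpha> else V \<alpha>)" for \<alpha>
  define \<W> where "\<W> = range e"
  have sub: "\<W> \<subseteq> \<U>"
    using u V(1) by (auto simp: \<W>_def e_def)
  have "x \<in> e x" for x
    using u[of x] V(2)[of x] by (cases "x \<le> \<beta>") (auto simp: e_def subset_iff)
  then have cover: "open_cover \<W>"
    using U sub unfolding open_cover_def \<W>_def by blast
  \<comment> \<open>Up to \<beta> the apex is the member chosen for \<open>x\<close>; beyond, it is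
    \<open>e \<gamma>\<close>, which contains \<open>{\<beta><..\<gamma>}\<close> once
    \<open>\<beta> < \<gamma>\<close>.\<close>
  define E where "E \<gamma> x = e (if x \<le> \<beta> then x else \<gamma>)" for \<gamma> x
  have E_W: "E \<gamma> x \<in> \<W>" for \<gamma> x
    by (simp add: E_def \<W>_def)
  \<comment> \<open>One neighbourhood works for all \<open>\<gamma> \<ge> x\<close>, and it is
    bounded, so limits are attained on it uniformly.\<close>
  have nbhd: "\<exists>N. open N \<and> x \<in> N \<and> N \<subseteq> {..max x \<beta>} \<and> (\<forall>\<gamma>\<ge>x. \<forall>y\<in>N. y \<in> E \<gamma> y \<and> E \<gamma> y = E \<gamma> x)" for x
  proof (cases "x \<le> \<beta>")
    case True
    from u[OF True] obtain N where N: "open N" "x \<in> N" "N \<subseteq> {..\<beta>}" "\<forall>y\<in>N. u y = u x"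
      by blast
    have "y \<in> E \<gamma> y \<and> E \<gamma> y = E \<gamma> x" if "y \<in> N" for y \<gamma>
    proof -
      have "y \<le> \<beta>" "u y = u x"
        using N that by blast+
      with u[of y] True show ?thesis
        by (simp add: E_def e_def)
    qed
    moreover have "N \<subseteq> {..max x \<beta>}"
      using N(3) True by (simp add: max_absorb2)
    ultimately show ?thesis
      using N(1,2) by blast
  next
    case False
    have "y \<in> E \<gamma> y \<and> E \<gamma> y = E \<gamma> x" if "x \<le> \<gamma>" "y \<in> {\<beta><..x}" for y \<gamma>
    proof -
      have "\<beta> < \<gamma>" "y \<in> {\<beta><..\<gamma>}"
        using that False by auto
      with V(2)[of \<gamma>] that False show ?thesis
        by (auto simp: E_def e_def)
    qed
    moreover have "x \<in> {\<beta><..x}" "{\<beta><..x} \<subseteq> {..max x \<beta>}"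
      using False by auto
    ultimately show ?thesis
      using open_greaterThanAtMost_wc[of \<beta> x] by blast
  qed
  have E_mem: "x \<in> E \<gamma> x" if "x \<le> \<gamma>" for x \<gamma>
    using nbhd[of x] that by blast
  obtain F :: "'k filter" and t where F: "F \<noteq> bot" "F \<le> at_top"
    and t: "\<And>l \<zeta>. \<forall>\<^sub>F \<gamma> in F. \<forall>x<\<zeta>. c (map e l @ [E \<gamma> x]) x = t l x"
    by (rule limit_filter[OF wc small, of "\<lambda>\<gamma> l x. c (map e l @ [E \<gamma> x]) x"]) (rule that)
  have ge: "\<forall>\<^sub>F \<gamma> in F. y \<le> \<gamma>" for y
    using eventually_ge_at_top filter_leD[OF F(2)] by blast
  \<comment> \<open>Limits are indexed by lists of ordinals, so each tuple of members is named by
    chosen indices.\<close>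
  define idx where "idx = map (inv_into UNIV e)"
  have idx: "map e (idx s) = s" if "set s \<subseteq> \<W>" for s
    using that by (auto simp: idx_def \<W>_def f_inv_into_f subset_iff intro!: map_idI)
  \<comment> \<open>An \<open>m\<close>-cochain takes tuples of length \<open>n\<close>. The sign
    comes from \<open>alt_cancel\<close> for the \<open>n + 1\<close> faces of a longer tuple, as
    \<open>n + 2\<close> and \<open>n\<close> have the same parity.\<close>
  define \<psi> where "\<psi> s x = (if s \<in> cover_tuples m \<W> \<and> x \<in> \<Inter>(set s) then alt n (t (idx s) x) else 0)" for s x
  have lim: "\<forall>\<^sub>F \<gamma> in F. \<forall>x<\<zeta>. c (s @ [E \<gamma> x]) x = t (idx s) x" if "set s \<subseteq> \<W>" for s \<zeta>
    using t[of \<zeta> "idx s"] idx[OF that] by simp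
  have cochain: "\<psi> \<in> cech_cochains m \<W>"
  proof -
    have "\<exists>M. open M \<and> x \<in> M \<and> (\<forall>y\<in>M \<inter> \<Inter>(set s). \<psi> s y = \<psi> s x)"
      if s: "s \<in> cover_tuples m \<W>" and x: "x \<in> \<Inter>(set s)" for s x
    proof -
      obtain N where N: "open N" "x \<in> N" "N \<subseteq> {..max x \<beta>}"
        and NE: "\<forall>\<gamma>\<ge>x. \<forall>y\<in>N. y \<in> E \<gamma> y \<and> E \<gamma> y = E \<gamma> x"
        using nbhd[of x] by (elim exE conjE)
      obtain \<zeta> where \<zeta>: "max x \<beta> < \<zeta>"
        using ex_greater[OF wc] by blast
      have "set s \<subseteq> \<W>"
        using s by (simp add: cover_tuples_def)
      \<comment> \<open>For such a \<gamma>, near \<open>x\<close> the limit \<open>\<psi> s\<close>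
        is up to sign the section \<open>c (s @ [K])\<close> with one fixed apex \<open>K\<close>,
        hence locally constant.\<close>
      from eventually_happens'[OF F(1) eventually_conj[OF ge[of x] lim[OF this, of \<zeta>]]]
      obtain \<gamma> where \<gamma>: "x \<le> \<gamma>" "\<And>y. y < \<zeta> \<Longrightarrow> c (s @ [E \<gamma> y]) y = t (idx s) y"
        by blast
      define K where "K = E \<gamma> x"
      have "s @ [K] \<in> cover_tuples n \<U>"
        using s sub E_W[of \<gamma> x] by (auto simp: cover_tuples_def n K_def)
      then have "locally_constant_on (\<Inter>(set (s @ [K]))) (c (s @ [K]))"
        using c by (auto simp: cech_cocycles_def cech_cochains_def)
      moreover have "x \<in> \<Inter>(set (s @ [K]))"
        using x E_mem[OF \<gamma>(1)] by (auto simp: K_def)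
      ultimately obtain N' where N': "open N'" "x \<in> N'"
        "\<And>y. y \<in> N' \<inter> \<Inter>(set (s @ [K])) \<Longrightarrow> c (s @ [K]) y = c (s @ [K]) x"
        unfolding locally_constant_on_def by meson
      have \<psi>_K: "\<psi> s y = alt n (c (s @ [K]) y)" if "y \<in> N" "y \<in> \<Inter>(set s)" for y
      proof -
        have "y \<le> max x \<beta>"
          using N(3) that(1) by blast
        then have "y < \<zeta>"
          using \<zeta> by (rule le_less_trans)
        then show ?thesis
          using \<gamma>(2)[of y] NE[rule_format, OF \<gamma>(1) that(1)] s that(2) by (simp add: \<psi>_def K_def)
      qed
      have "\<psi> s y = \<psi> s x" if "y \<in> N \<inter> N' \<inter> \<Inter>(set s)" for y
      proof -
        have "y \<in> K"
          using NE[rule_format, OF \<gamma>(1), of y] that by (auto simp: K_def)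
        then have "c (s @ [K]) y = c (s @ [K]) x"
          using that by (intro N'(3)) auto
        then show ?thesis
          using \<psi>_K[of y] \<psi>_K[OF N(2) x] that by auto
      qed
      then show ?thesis
        using N N' by (intro exI[of _ "N \<inter> N'"]) (auto intro: open_Int)
    qed
    then show ?thesis
      by (auto simp: cech_cochains_def locally_constant_on_def \<psi>_def)
  qed
  have "(\<Sum>i\<le>Suc m. alt i (\<psi> (del i s) x)) = c s x"
    if s: "s \<in> cover_tuples n \<W>" and x: "x \<in> \<Inter>(set s)" for s x
  proof -
    have len: "length s = Suc n" and sW: "set s \<subseteq> \<W>"
      using s by (auto simp: cover_tuples_def)
    have del: "del i s \<in> cover_tuples m \<W>" "x \<in> \<Inter>(set (del i s))" if "i < Suc n" for i
      using that len sW x set_del_subset[of i s] by (auto simp: cover_tuples_def length_del n)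
    obtain \<zeta> where \<zeta>: "x < \<zeta>"
      using ex_greater[OF wc] by blast
    have "\<forall>\<^sub>F \<gamma> in F. \<forall>i\<in>{..<Suc n}. \<forall>y<\<zeta>. c (del i s @ [E \<gamma> y]) y = t (idx (del i s)) y"
      by (intro eventually_ball_finite ballI lim subset_trans[OF set_del_subset sW]) simp
    \<comment> \<open>At this \<gamma> all faces have reached their limits at \<open>x\<close>, so
      the cocycle condition on \<open>s @ [E \<gamma> x]\<close> speaks about
      \<open>\<psi>\<close>.\<close>
    from eventually_happens'[OF F(1) eventually_conj[OF ge[of x] this]]
    obtain \<gamma> where \<gamma>: "x \<le> \<gamma>"
      "\<And>i. i < Suc n \<Longrightarrow> c (del i s @ [E \<gamma> x]) x = t (idx (del i s)) x"
      using \<zeta> by blast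
    have "s @ [E \<gamma> x] \<in> cover_tuples (Suc n) \<U>" "x \<in> \<Inter>(set (s @ [E \<gamma> x]))"
      using s x sub E_W[of \<gamma> x] E_mem[OF \<gamma>(1)] by (auto simp: cover_tuples_def)
    moreover have "cech_diff n \<U> c (s @ [E \<gamma> x]) x = 0"
      using c by (simp add: cech_cocycles_def)
    ultimately have "(\<Sum>i\<le>Suc n. alt i (c (del i (s @ [E \<gamma> x])) x)) = 0"
      by (simp only: cech_diff_def simp_thms if_True)
    then have "(\<Sum>i<Suc n. alt i (c (del i s @ [E \<gamma> x]) x)) + alt (Suc n) (c s x) = 0"
      using sum_del_append_last[OF len, of "\<lambda>s. c s x" "E \<gamma> x"] by (simp only:)
    then have "(\<Sum>i<Suc n. alt i (alt (Suc (Suc n)) (c (del i s @ [E \<gamma> x]) x))) = c s x"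
      by (rule alt_cancel)
    moreover have "\<psi> (del i s) x = alt (Suc (Suc n)) (c (del i s @ [E \<gamma> x]) x)" if "i < Suc n" for i
      using del[OF that] \<gamma>(2)[OF that] by (simp add: \<psi>_def alt_def)
    ultimately show ?thesis
      by (simp add: n lessThan_Suc_atMost)
  qed
  then have "cech_pullback n \<W> id c = cech_diff m \<W> \<psi>"
    by (auto simp: fun_eq_iff cech_pullback_def cech_diff_def n)
  with cochain have "cech_pullback n \<W> id c \<in> cech_coboundaries n \<W>"
    by (auto simp: cech_coboundaries_def n)
  with sub cover show ?thesis
    by blast
qed

end

section \<open>Differences, pullbacks and common refinements\<close>

lemma locally_constant_on_subset:
  "locally_constant_on S f \<Longrightarrow> T \<subseteq> S \<Longrightarrow> locally_constant_on T f"
  unfolding locally_constant_on_def by (meson IntD1 IntD2 IntI subsetD)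

lemma locally_constant_on_diff:
  assumes "locally_constant_on S f" "locally_constant_on S g"
  shows "locally_constant_on S (\<lambda>x. f x - g x)"
  unfolding locally_constant_on_def
proof
  fix x assume "x \<in> S"
  then obtain M N where "open M" "x \<in> M" "\<forall>y\<in>M \<inter> S. f y = f x" "open N" "x \<in> N" "\<forall>y\<in>N \<inter> S. g y = g x"
    using assms unfolding locally_constant_on_def by meson
  then show "\<exists>N. open N \<and> x \<in> N \<and> (\<forall>y\<in>N \<inter> S. f y - g y = f x - g x)"
    by (intro exI[of _ "M \<inter> N"]) auto
qed

lemma cech_cocycles_diff:
  assumes "c \<in> cech_cocycles n \<U>" "d \<in> cech_cocycles n \<U>"
  shows "(\<lambda>s x. c s x - d s x) \<in> cech_cocycles n \<U>"
proof -
  have "cech_diff n \<U> (\<lambda>s x. c s x - d s x) = (\<lambda>s x. cech_diff n \<U> c s x - cech_diff n \<U> d s x)"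
    by (auto simp: fun_eq_iff cech_diff_def alt_def sum_subtractf[symmetric] intro!: sum.cong)
  with assms show ?thesis
    by (auto simp: cech_cocycles_def cech_cochains_def intro: locally_constant_on_diff)
qed

text \<open>Deletion commutes with \<open>map\<close>, so pullback commutes with the differential;
  intersections only grow under \<tau>, so sections restrict.\<close>

lemma cech_pullback_cocycle:
  assumes \<tau>: "refines_via \<V> \<tau> \<U>" and c: "c \<in> cech_cocycles n \<U>"
  shows "cech_pullback n \<V> \<tau> c \<in> cech_cocycles n \<V>"
proof -
  have tup: "map \<tau> s \<in> cover_tuples k \<U>" "\<Inter>(set s) \<subseteq> \<Inter>(set (map \<tau> s))"
    if "s \<in> cover_tuples k \<V>" for k s
    using that \<tau> by (force simp: cover_tuples_def refines_via_def)+
  have "locally_constant_on (\<Inter>(set s)) (cech_pullback n \<V> \<tau> c s)" if s: "s \<in> cover_tuples n \<V>" for s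
  proof -
    have "locally_constant_on (\<Inter>(set (map \<tau> s))) (c (map \<tau> s))"
      using c tup(1)[OF s] unfolding cech_cocycles_def cech_cochains_def by blast
    then have "locally_constant_on (\<Inter>(set s)) (c (map \<tau> s))"
      using tup(2)[OF s] by (rule locally_constant_on_subset)
    with s show ?thesis
      by (simp add: locally_constant_on_def cech_pullback_def)
  qed
  moreover have "cech_diff n \<V> (cech_pullback n \<V> \<tau> c) s x = 0" for s x
  proof (cases "s \<in> cover_tuples (Suc n) \<V> \<and> x \<in> \<Inter>(set s)")
    case True
    then have "map \<tau> s \<in> cover_tuples (Suc n) \<U> \<and> x \<in> \<Inter>(set (map \<tau> s))"
      using tup by blast
    moreover have "cech_diff n \<U> c (map \<tau> s) x = 0"
      using c by (simp add: cech_cocycles_def)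
    ultimately have "(\<Sum>i\<le>Suc n. alt i (c (del i (map \<tau> s)) x)) = 0"
      by (simp only: cech_diff_def simp_thms if_True)
    moreover have "cech_pullback n \<V> \<tau> c (del i s) x = c (del i (map \<tau> s)) x" if "i \<le> Suc n" for i
      using that True set_del_subset[of i s]
      by (auto simp: cech_pullback_def map_del cover_tuples_def length_del)
    ultimately show ?thesis
      by (simp add: cech_diff_def)
  next
    case False
    then show ?thesis
      unfolding cech_diff_def by (rule if_not_P)
  qed
  then have "cech_diff n \<V> (cech_pullback n \<V> \<tau> c) = (\<lambda>s x. 0)"
    by blast
  moreover have "cech_pullback n \<V> \<tau> c s x = 0" if "\<not> (s \<in> cover_tuples n \<V> \<and> x \<in> \<Inter>(set s))" for s x
    unfolding cech_pullback_def using that by (rule if_not_P)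
  ultimately show ?thesis
    unfolding cech_cocycles_def cech_cochains_def by blast
qed

lemma open_cover_common_refinement:
  assumes "open_cover \<U>" "open_cover \<V>"
  obtains \<W> \<sigma> \<tau> where "open_cover \<W>" "refines_via \<W> \<sigma> \<U>" "refines_via \<W> \<tau> \<V>"
proof -
  define \<W> where "\<W> = {U \<inter> V |U V. U \<in> \<U> \<and> V \<in> \<V>}"
  have "\<exists>W\<in>\<W>. x \<in> W" for x
  proof -
    obtain U V where "U \<in> \<U>" "x \<in> U" "V \<in> \<V>" "x \<in> V"
      using assms unfolding open_cover_def by (metis UNIV_I UnionE)
    then show ?thesis
      by (auto simp: \<W>_def)
  qed
  then have "open_cover \<W>"
    using assms by (auto simp: open_cover_def \<W>_def)
  moreover have "\<forall>W\<in>\<W>. \<exists>U V. U \<in> \<U> \<and> W \<subseteq> U \<and> V \<in> \<V> \<and> W \<subseteq> V"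
    by (auto simp: \<W>_def)
  then obtain \<sigma> \<tau> where "\<forall>W\<in>\<W>. \<sigma> W \<in> \<U> \<and> W \<subseteq> \<sigma> W \<and> \<tau> W \<in> \<V> \<and> W \<subseteq> \<tau> W"
    by metis
  ultimately show thesis
    by (intro that[of \<W> \<sigma> \<tau>]) (auto simp: refines_via_def)
qed

section \<open>Collapse of the colimit\<close>

text \<open>On a common refinement the difference of two cocycles is a cocycle, so it bounds on a
  subcover, which refines both covers by the same maps.\<close>

lemma cech_rel_full:
  assumes wc: "weakly_compact TYPE('k::{wellorder, linorder_topology})" and "n > 0"
    and small: "(UNIV :: 'a::ab_group_add set) \<prec> (UNIV :: 'k set)"
  shows "cech_rel n = cech_reps n \<times> (cech_reps n :: ('k, 'a) cech_rep set)"
proof -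
  have "((\<U>, c), (\<V>, d)) \<in> cech_rel n"
    if U: "open_cover \<U>" "c \<in> cech_cocycles n \<U>" and V: "open_cover \<V>" "d \<in> cech_cocycles n \<V>"
    for \<U> \<V> :: "'k set set" and c d :: "'k set list \<Rightarrow> 'k \<Rightarrow> 'a"
  proof -
    obtain \<X> \<sigma> \<tau> where X: "open_cover \<X>" "refines_via \<X> \<sigma> \<U>" "refines_via \<X> \<tau> \<V>"
      using open_cover_common_refinement[OF U(1) V(1)] .
    define b where "b = (\<lambda>s x. cech_pullback n \<X> \<sigma> c s x - cech_pullback n \<X> \<tau> d s x)"
    have "b \<in> cech_cocycles n \<X>"
      unfolding b_def using X U V by (intro cech_cocycles_diff cech_pullback_cocycle)
    from cech_cocycle_bounds_on_subcover[OF wc small \<open>n > 0\<close> X(1) this]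
    obtain \<W> where W: "\<W> \<subseteq> \<X>" "open_cover \<W>" "cech_pullback n \<W> id b \<in> cech_coboundaries n \<W>"
      by blast
    have eq: "cech_pullback n \<W> id b = (\<lambda>s x. cech_pullback n \<W> \<sigma> c s x - cech_pullback n \<W> \<tau> d s x)"
      using W(1) by (auto simp: fun_eq_iff b_def cech_pullback_def cover_tuples_def)
    have "refines_via \<W> \<sigma> \<U>" "refines_via \<W> \<tau> \<V>"
      using W(1) X by (auto simp: refines_via_def)
    with W(2) W(3)[unfolded eq] have "\<exists>\<W> \<sigma> \<tau>. open_cover \<W> \<and> refines_via \<W> \<sigma> \<U> \<and> refines_via \<W> \<tau> \<V> \<and>
        (\<lambda>s x. cech_pullback n \<W> \<sigma> c s x - cech_pullback n \<W> \<tau> d s x) \<in> cech_coboundaries n \<W>"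
      by (intro exI conjI)
    with U V show ?thesis
      by (simp add: cech_rel_def cech_reps_def)
  qed
  then show ?thesis
    by (auto simp: cech_reps_def) (auto simp: cech_rel_def cech_reps_def)
qed

text \<open>All representatives form a single class, so it remains to see that adding this class to
  itself gives it back.\<close>

lemma trivial_group_cech_cohomology:
  assumes wc: "weakly_compact TYPE('k::{wellorder, linorder_topology})" and "n > 0"
    and small: "(UNIV :: 'a::ab_group_add set) \<prec> (UNIV :: 'k set)"
  shows "trivial_group (cech_cohomology n :: ('k, 'a) cech_rep set monoid)"
proof -
  let ?G = "cech_cohomology n :: ('k, 'a) cech_rep set monoid"
  let ?R = "cech_reps n :: ('k, 'a) cech_rep set"
  let ?z = "({UNIV}, \<lambda>s x. 0) :: ('k, 'a) cech_rep"
  have rel: "cech_rel n = ?R \<times> ?R"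
    using cech_rel_full[OF assms] .
  have z: "?z \<in> ?R"
    by (auto simp: cech_reps_def open_cover_def cech_cocycles_def cech_cochains_def cech_diff_def
        locally_constant_on_def alt_def fun_eq_iff simp del: sum.atMost_Suc intro!: sum.neutral)
  have one: "one ?G = ?R"
    using z by (auto simp: cech_cohomology_def rel)
  have carrier: "carrier ?G = {?R}"
    using z by (auto simp: cech_cohomology_def rel quotient_def)
  have "monoid.mult ?G ?R ?R = ?R"
  proof -
    define S :: "('k, 'a) cech_rep set" where
      "S = {(\<W>, \<lambda>s x. cech_pullback n \<W> \<sigma> c s x + cech_pullback n \<W> \<tau> d s x) | \<W> \<sigma> \<tau> \<U> c \<V> d.
           (\<U>, c) \<in> ?R \<and> (\<V>, d) \<in> ?R \<and>
           open_cover \<W> \<and> refines_via \<W> \<sigma> \<U> \<and> refines_via \<W> \<tau> \<V>}"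
    \<comment> \<open>The zero cocycle on the one-member cover is a sum of representatives, so
      saturating \<open>S\<close> yields the whole class.\<close>
    have "?z \<in> S"
      unfolding S_def
      by (rule CollectI, rule exI[of _ "{UNIV}"], rule exI[of _ id], rule exI[of _ id],
          rule exI[of _ "{UNIV}"], rule exI[of _ "\<lambda>s x. 0"], rule exI[of _ "{UNIV}"],
          rule exI[of _ "\<lambda>s x. 0"])
        (use z in \<open>simp add: cech_pullback_def open_cover_def refines_via_def\<close>)
    then have "(?R \<times> ?R) `` S = ?R"
      using z by blast
    then show ?thesis
      by (simp add: cech_cohomology_def S_def rel)
  qed
  then have "group ?G"
    by (intro groupI) (simp_all add: carrier one)
  then show ?thesis
    by (simp add: trivial_group_def carrier one)
qed

theorem theorem3p4:
  fixes n :: nat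
  assumes "weakly_compact TYPE('k::{wellorder, linorder_topology})"
    and "n > 0"
    and "(UNIV :: 'a::ab_group_add set) \<prec> (UNIV :: 'k set)"
  shows "(\<forall>\<phi> :: 'k list \<Rightarrow> 'k \<Rightarrow> 'a. n_coherent n \<phi> \<longrightarrow> n_trivial n \<phi>) \<and>
         trivial_group (cech_cohomology n :: ('k, 'a) cech_rep set monoid)"
  using n_coherent_imp_n_trivial[OF assms] trivial_group_cech_cohomology[OF assms] by blast

end
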